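(* Let $m>1$ be an integer with $m\neq 4$. Then every positive integer $n$ divisible by $5$ satisfies $D_m(n)<n$.
   Context: For $m,n\in\mathbb{N}$, the Schemmel totient function $L_m(n)$ is the number of integers $k\in\{1,\dots,n\}$ such that $\gcd(k+s,n)=1$ for all $s\in\{0,1,\dots,m-1\}$; by convention $L_m(0)=0$. Equivalently, $L_m(1)=1$, and for $n>1$ with $n=\prod_{i=1}^r p_i^{\alpha_i}$, $L_m(n)=0$ if the smallest prime factor of $n$ is $\le m$, and $L_m(n)=\prod_{i} p_i^{\alpha_i-1}(p_i-m)$ otherwise. Iterates: $f^{(1)}=f$, $f^{(k+1)}=f\circ f^{(k)}$. $R_m(n)$ is the least positive integer $k$ with $L_m^{(k)}(n)\in\{0,1\}$. Define $D_m(1)=0$ and $D_m(n)=\sum_{i=1}^{R_m(n)}L_m^{(i)}(n)$ for $n>1$. *)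

theory Defs
  imports Main
begin

definition schemmel :: "nat \<Rightarrow> nat \<Rightarrow> nat" where
  "schemmel m n = card {k \<in> {1..n}. \<forall>s\<in>{0..<m}. gcd (k + s) n = 1}"

text \<open>For \<open>m > 0\<close> a \<open>k\<close> as below always exists, since then \<open>schemmel m n < n\<close> whenever
  \<open>n > 1\<close>.  For \<open>m = 0\<close> (where \<open>schemmel 0 n = n\<close>) and \<open>n > 1\<close> there is none, and the value is
  unspecified.\<close>

definition schemmel_R :: "nat \<Rightarrow> nat \<Rightarrow> nat" where
  "schemmel_R m n = (LEAST k. k > 0 \<and> (schemmel m ^^ k) n \<in> {0, 1})"

text \<open>The value at \<open>n = 0\<close>, which the mathematical definition leaves out, comes out as \<open>0\<close>
  (for \<open>schemmel m 0 = 0\<close>).\<close>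

definition schemmel_D :: "nat \<Rightarrow> nat \<Rightarrow> nat" where
  "schemmel_D m n = (if n = 1 then 0 else (\<Sum>i=1..schemmel_R m n. (schemmel m ^^ i) n))"

end

theory Submission
  imports Defs "HOL-Number_Theory.Cong"
begin

text \<open>For \<open>m \<ge> 5\<close> the first iterate vanishes, and for \<open>m = 3\<close> the factor \<open>5 - 3 = 2\<close> kills the
  second one. Let \<open>m = 2\<close>. The iterates cannot avoid multiples of 3 for long, and at each multiple
  of 3 they drop by a factor 3; this gives \<open>D(x) < x\<close> if \<open>3\<close> divides \<open>x\<close>, and \<open>D(x) < 2x\<close> if some
  prime factor of \<open>x\<close> is 2 modulo 3. If \<open>5\<close> divides \<open>n\<close>, then the first two iterates are at most
  \<open>3n/5\<close> and \<open>n/5\<close>, and the second one is again divisible by 3 (unless \<open>3\<close> divides \<open>n\<close> or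
  \<open>n = 5\<close>), so that \<open>D(n) < 3n/5 + n/5 + n/5 = n\<close>.\<close>

section \<open>Product formula over prime powers\<close>

text \<open>Starting at 0 rather than 1 gives canonical residues, to which \<open>div\<close>,
  \<open>mod\<close> and Chinese remainders apply directly.\<close>

definition schemmel_residues :: "nat \<Rightarrow> nat \<Rightarrow> nat set" where
  "schemmel_residues m n = {k \<in> {..<n}. \<forall>s<m. coprime (k + s) n}"

lemma coprime_mod_add_iff:
  fixes k s n :: nat
  shows "coprime (k mod n + s) n \<longleftrightarrow> coprime (k + s) n"
proof (rule coprime_cong_cong_left)
  show "[k mod n + s = k + s] (mod n)"
    unfolding cong_def by (rule mod_add_left_eq)
qed

lemma schemmel_eq_card_residues: "schemmel m n = card (schemmel_residues m n)"
proof (cases "n = 0")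
  case True
  then show ?thesis by (simp add: schemmel_def schemmel_residues_def)
next
  case False
  then have n: "n > 0" by simp
  let ?A = "{k \<in> {1..n}. \<forall>s<m. coprime (k + s) n}"
  have "bij_betw (\<lambda>k. k mod n) ?A (schemmel_residues m n)"
  \<comment> \<open>Only \<open>n\<close> moves, to 0; every other \<open>k\<close> is its own
    residue.\<close>
  proof (rule bij_betw_byWitness[where f' = "\<lambda>k. if k = 0 then n else k"])
    show "(\<lambda>k. k mod n) ` ?A \<subseteq> schemmel_residues m n"
      using n by (auto simp: schemmel_residues_def coprime_mod_add_iff)
    show "(\<lambda>k. if k = 0 then n else k) ` schemmel_residues m n \<subseteq> ?A"
    proof
      fix k assume "k \<in> (\<lambda>k. if k = 0 then n else k) ` schemmel_residues m n"
      then obtain l where k: "k = (if l = 0 then n else l)" and l: "l \<in> schemmel_residues m n"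
        by blast
      have "l < n" using l by (simp add: schemmel_residues_def)
      then have kl: "k mod n = l" "k \<in> {1..n}" using k by (auto split: if_splits)
      then have "coprime (k + s) n" if "s < m" for s
        using l that coprime_mod_add_iff[of k n s] by (simp add: schemmel_residues_def)
      with kl show "k \<in> ?A" by blast
    qed
    show "\<forall>k\<in>?A. (if k mod n = 0 then n else k mod n) = k"
      by (auto simp: le_less)
    show "\<forall>k\<in>schemmel_residues m n. (if k = 0 then n else k) mod n = k"
      by (auto simp: schemmel_residues_def)
  qed
  then have "card ?A = card (schemmel_residues m n)" by (rule bij_betw_same_card)
  moreover have "{k \<in> {1..n}. \<forall>s\<in>{0..<m}. gcd (k + s) n = 1} = ?A"
    unfolding coprime_iff_gcd_eq_1 by auto
  ultimately show ?thesis unfolding schemmel_def by simp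
qed

text \<open>Chinese remainders: an admissible residue modulo \<open>a * b\<close> is a pair of
  admissible residues, since each \<open>k + s\<close> can be tested modulo \<open>a\<close> and
  \<open>b\<close> separately.\<close>

lemma schemmel_mult_coprime:
  assumes ab: "coprime a b"
  shows "schemmel m (a * b) = schemmel m a * schemmel m b"
proof (cases "a = 0 \<or> b = 0")
  case True
  then show ?thesis by (auto simp: schemmel_eq_card_residues schemmel_residues_def)
next
  case False
  then have pos: "a > 0" "b > 0" by auto
  have "bij_betw (\<lambda>k. (k mod a, k mod b)) (schemmel_residues m (a * b))
    (schemmel_residues m a \<times> schemmel_residues m b)"
    unfolding bij_betw_def
  proof
    show "inj_on (\<lambda>k. (k mod a, k mod b)) (schemmel_residues m (a * b))"
    proof (rule inj_onI)
      fix x y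
      assume "x \<in> schemmel_residues m (a * b)" "y \<in> schemmel_residues m (a * b)"
        and eq: "(x mod a, x mod b) = (y mod a, y mod b)"
      then have lt: "x < a * b" "y < a * b" by (auto simp: schemmel_residues_def)
      have "[x = y] (mod a * b)"
        using eq ab by (intro coprime_cong_mult_nat) (auto simp: cong_def)
      then show "x = y" using lt by (simp add: cong_less_modulus_unique_nat)
    qed
    show "(\<lambda>k. (k mod a, k mod b)) ` schemmel_residues m (a * b)
      = schemmel_residues m a \<times> schemmel_residues m b" (is "?f ` ?A = ?B")
    proof
      show "?f ` ?A \<subseteq> ?B"
        using pos by (auto simp: schemmel_residues_def coprime_mod_add_iff)
      show "?B \<subseteq> ?f ` ?A"
      proof
        fix z assume z: "z \<in> ?B"
        then obtain x y where xy: "z = (x, y)" "x \<in> schemmel_residues m a" "y \<in> schemmel_residues m b"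
          by auto
        then have lt: "x < a" "y < b" by (auto simp: schemmel_residues_def)
        obtain k where k: "k < a * b" "[k = x] (mod a)" "[k = y] (mod b)"
          using binary_chinese_remainder_unique_nat[OF ab, of x y] pos by auto
        then have kk: "k mod a = x" "k mod b = y" using lt by (auto simp: cong_def)
        have "coprime (k + s) (a * b)" if "s < m" for s
          using that xy coprime_mod_add_iff[of k a s] coprime_mod_add_iff[of k b s]
          by (auto simp: schemmel_residues_def kk)
        then have "k \<in> ?A" using k by (auto simp: schemmel_residues_def)
        then show "z \<in> ?f ` ?A" using kk xy by force
      qed
    qed
  qed
  then have "card (schemmel_residues m (a * b)) = card (schemmel_residues m a \<times> schemmel_residues m b)"
    by (rule bij_betw_same_card)
  then show ?thesis
    by (simp add: schemmel_eq_card_residues card_cartesian_product)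
qed

text \<open>With \<open>k = p * q + r\<close>, coprimality restricts only \<open>r\<close>, to
  \<open>{1..p - m}\<close>, while \<open>q\<close> takes all \<open>p ^ a\<close> values. For
  \<open>p \<le> m\<close> truncated subtraction gives 0.\<close>

lemma schemmel_prime_power:
  assumes p: "prime p" and m: "m > 0"
  shows "schemmel m (p ^ Suc a) = p ^ a * (p - m)"
proof -
  have p0: "p > 0" using p by (simp add: prime_gt_0_nat)
  have cop: "coprime x (p ^ Suc a) \<longleftrightarrow> \<not> p dvd x" for x :: nat
  proof -
    have "coprime p x \<longleftrightarrow> \<not> p dvd x"
      using p by (meson prime_imp_coprime coprime_absorb_left not_prime_unit)
    then show ?thesis
      by (simp add: coprime_commute[of x] del: power_Suc)
  qed
  have key: "(\<forall>s<m. \<not> p dvd r + s) \<longleftrightarrow> r \<in> {1..p - m}" if "r < p" for r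
  proof
    assume H: "\<forall>s<m. \<not> p dvd r + s"
    \<comment> \<open>The shift \<open>s = 0\<close> rules out \<open>r = 0\<close>; the shift
      \<open>s = p - r\<close> would hit the multiple \<open>p\<close>.\<close>
    have "r > 0" using H m by (auto intro!: Nat.gr0I)
    moreover have "\<not> p - r < m" using H that by auto
    ultimately show "r \<in> {1..p - m}" using that by auto
  next
    assume "r \<in> {1..p - m}"
    then show "\<forall>s<m. \<not> p dvd r + s" by (auto dest!: dvd_imp_le)
  qed
  have "bij_betw (\<lambda>k. (k div p, k mod p)) (schemmel_residues m (p ^ Suc a)) ({..<p ^ a} \<times> {1..p - m})"
  proof (rule bij_betw_byWitness[where f' = "\<lambda>(q, r). p * q + r"])
    show "\<forall>k\<in>schemmel_residues m (p ^ Suc a). (case (k div p, k mod p) of (q, r) \<Rightarrow> p * q + r) = k"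
      by simp
    show "\<forall>z\<in>{..<p ^ a} \<times> {1..p - m}.
        ((case z of (q, r) \<Rightarrow> p * q + r) div p, (case z of (q, r) \<Rightarrow> p * q + r) mod p) = z"
      using m by auto
    show "(\<lambda>k. (k div p, k mod p)) ` schemmel_residues m (p ^ Suc a) \<subseteq> {..<p ^ a} \<times> {1..p - m}"
    proof clarify
      fix k assume k: "k \<in> schemmel_residues m (p ^ Suc a)"
      then have "k < p ^ a * p" and nd: "\<forall>s<m. \<not> p dvd k + s"
        using cop by (auto simp: schemmel_residues_def mult.commute)
      then have "k div p < p ^ a" by (simp add: less_mult_imp_div_less)
      moreover have "\<forall>s<m. \<not> p dvd k mod p + s"
        using nd by (simp add: dvd_eq_mod_eq_0 mod_add_left_eq)
      then have "k mod p \<in> {1..p - m}" using key p0 by simp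
      ultimately show "k div p \<in> {..<p ^ a} \<and> k mod p \<in> {1..p - m}" by simp
    qed
    show "(\<lambda>(q, r). p * q + r) ` ({..<p ^ a} \<times> {1..p - m}) \<subseteq> schemmel_residues m (p ^ Suc a)"
    proof
      fix k assume "k \<in> (\<lambda>(q, r). p * q + r) ` ({..<p ^ a} \<times> {1..p - m})"
      then obtain q r where k: "k = p * q + r" and q: "q \<in> {..<p ^ a}" and r: "r \<in> {1..p - m}"
        by auto
      then have rp: "r < p" using m by auto
      have "p * q + r < p * Suc q" using rp by simp
      also have "\<dots> \<le> p * p ^ a" using q by (intro mult_le_mono2) simp
      finally have "p * q + r < p ^ Suc a" by simp
      moreover have "\<not> p dvd p * q + r + s" if "s < m" for s
        using key[OF rp] r that by (simp add: add.assoc dvd_add_right_iff)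
      ultimately show "k \<in> schemmel_residues m (p ^ Suc a)"
        unfolding k schemmel_residues_def cop by simp
    qed
  qed
  then have "card (schemmel_residues m (p ^ Suc a)) = card ({..<p ^ a} \<times> {1..p - m})"
    by (rule bij_betw_same_card)
  then show ?thesis by (simp add: schemmel_eq_card_residues card_cartesian_product)
qed

section \<open>Divisibility and size from one prime factor\<close>

lemma prime_power_split:
  fixes p n :: nat
  assumes "prime p" "p dvd n" "n > 0"
  obtains a k where "n = p ^ Suc a * k" "\<not> p dvd k"
proof -
  obtain a k where ak: "\<not> p dvd k" "n = k * p ^ a"
    using prime_power_canonical[OF assms(1,3)] by blast
  with assms(2) obtain b where "a = Suc b" by (cases a) auto
  with ak that[of b k] show thesis by (simp add: mult.commute)
qed

lemma schemmel_split:
  assumes p: "prime p" and m: "m > 0" and k: "\<not> p dvd k"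
  shows "schemmel m (p ^ Suc a * k) = p ^ a * (p - m) * schemmel m k"
proof -
  have "coprime (p ^ Suc a) k"
    using p k by (meson coprime_power_left_iff prime_imp_coprime)
  then show ?thesis by (simp only: schemmel_mult_coprime schemmel_prime_power[OF p m])
qed

text \<open>The candidate \<open>k = n\<close> fails already at \<open>s = 0\<close>.\<close>

lemma schemmel_less:
  assumes "m > 0" "n > 1"
  shows "schemmel m n < n"
proof -
  have "{k \<in> {1..n}. \<forall>s\<in>{0..<m}. gcd (k + s) n = 1} \<subseteq> {1..<n}"
    using assms by (force simp: le_less)
  then have "schemmel m n \<le> card {1..<n}"
    unfolding schemmel_def by (intro card_mono) auto
  then show ?thesis using assms by simp
qed

lemma schemmel_le: "schemmel m n \<le> n"
proof -
  have "schemmel m n \<le> card {1..n}"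
    unfolding schemmel_def by (intro card_mono) auto
  then show ?thesis by simp
qed

lemma schemmel_0 [simp]: "schemmel m 0 = 0"
  by (simp add: schemmel_def)

text \<open>For \<open>p \<le> m\<close> the divisor is 0, so this also shows when
  \<open>schemmel\<close> vanishes.\<close>

lemma prime_minus_dvd_schemmel:
  assumes "prime p" "m > 0" "p dvd n"
  shows "(p - m) dvd schemmel m n"
proof (cases "n = 0")
  case False
  then obtain a k where "n = p ^ Suc a * k" "\<not> p dvd k"
    using prime_power_split assms by blast
  then show ?thesis using schemmel_split[OF assms(1,2), of k a] by simp
qed simp

lemma prime_dvd_schemmel:
  assumes "prime p" "m > 0" "p * p dvd n"
  shows "p dvd schemmel m n"
proof (cases "n = 0")
  case False
  then obtain a k where ak: "n = p ^ Suc a * k" "\<not> p dvd k"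
    using prime_power_split assms by (metis dvd_mult_left gr0I)
  \<comment> \<open>If \<open>a = 0\<close>, the second factor \<open>p\<close> would have to divide
    \<open>k\<close>.\<close>
  then have "a \<noteq> 0" using assms prime_gt_0_nat[of p] by (intro notI) auto
  then show ?thesis using schemmel_split[OF assms(1,2), of k a] ak by simp
qed simp

text \<open>One factor \<open>p\<close> is traded for \<open>p - m\<close>, and the cofactor
  \<open>k\<close> does not grow.\<close>

lemma schemmel_prime_bound:
  assumes "prime p" "m > 0" "p dvd n"
  shows "p * schemmel m n \<le> (p - m) * n"
proof (cases "n = 0")
  case False
  then obtain a k where "n = p ^ Suc a * k" "\<not> p dvd k"
    using prime_power_split assms by blast
  then show ?thesis using schemmel_split[OF assms(1,2), of k a] schemmel_le[of m k] by simp
qed simp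

section \<open>Iteration and the recursion for \<open>schemmel_D\<close>\<close>

text \<open>Iterates strictly decrease while above 1; this makes the \<open>LEAST\<close> in
  \<open>schemmel_R\<close> meaningful.\<close>

lemma schemmel_iterate_reaches:
  assumes "m > 0"
  shows "\<exists>k. (schemmel m ^^ k) n \<le> 1"
proof (induction n rule: less_induct)
  case (less n)
  show ?case
  proof (cases "n > 1")
    case True
    then obtain k where "(schemmel m ^^ k) (schemmel m n) \<le> 1"
      using less schemmel_less[OF assms] by blast
    then have "(schemmel m ^^ Suc k) n \<le> 1" by (simp add: funpow_swap1)
    then show ?thesis by blast
  next
    case False
    then show ?thesis by (intro exI[of _ 0]) simp
  qed
qed

lemma schemmel_D_le_1: "n \<le> 1 \<Longrightarrow> schemmel_D m n = 0"
proof -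
  have "(schemmel m ^^ i) 0 = 0" for i by (induction i) auto
  then show "n \<le> 1 \<Longrightarrow> schemmel_D m n = 0" by (cases n) (auto simp: schemmel_D_def)
qed

text \<open>Above 1, passing to the first iterate lowers \<open>schemmel_R\<close> by one and shifts
  the sum. If that iterate is at most 1, the sum stops there, matching the value 0 of
  \<open>schemmel_D\<close> at 0 and 1.\<close>

lemma schemmel_D_rec:
  assumes m: "m > 0" and n: "n > 1"
  shows "schemmel_D m n = schemmel m n + schemmel_D m (schemmel m n)"
proof (cases "schemmel m n \<le> 1")
  case True
  then have "schemmel m n \<in> {0, 1}" by auto
  then have "schemmel_R m n = 1"
    unfolding schemmel_R_def by (intro Least_equality) auto
  then show ?thesis using n True schemmel_D_le_1[OF True] by (simp add: schemmel_D_def)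
next
  case False
  let ?P = "\<lambda>x k. k > 0 \<and> (schemmel m ^^ k) x \<in> {0, 1}"
  have shift: "(schemmel m ^^ Suc k) n = (schemmel m ^^ k) (schemmel m n)" for k
    by (simp add: funpow_swap1)
  obtain j where j: "(schemmel m ^^ j) (schemmel m n) \<le> 1"
    using schemmel_iterate_reaches[OF m] by blast
  then have "j \<noteq> 0" using False by (auto intro: Nat.gr0I)
  then have "?P n (Suc j)" using j by (auto simp: shift simp del: funpow.simps)
  moreover have "\<not> ?P n 0" by simp
  ultimately have "(LEAST k. ?P n k) = Suc (LEAST k. ?P n (Suc k))"
    by (rule Least_Suc)
  \<comment> \<open>At \<open>k = 0\<close> both sides are false: the left because
    \<open>schemmel m n > 1\<close>, the right because it demands \<open>k > 0\<close>.\<close>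
  also have "(\<lambda>k. ?P n (Suc k)) = ?P (schemmel m n)"
  proof
    fix k
    show "?P n (Suc k) = ?P (schemmel m n) k"
      using False by (cases k) (auto simp: shift simp del: funpow.simps)
  qed
  finally have "schemmel_R m n = Suc (schemmel_R m (schemmel m n))"
    by (simp only: schemmel_R_def)
  moreover have "(\<Sum>i=1..Suc r. (schemmel m ^^ i) n)
      = schemmel m n + (\<Sum>i=1..r. (schemmel m ^^ i) (schemmel m n))" for r
    using sum.atLeast_Suc_atMost_Suc_shift[of "\<lambda>i. (schemmel m ^^ i) n" 0 r]
      sum.atLeast_Suc_atMost[of 0 r "\<lambda>i. (schemmel m ^^ i) (schemmel m n)"]
    by (simp add: shift del: funpow.simps(2))
  ultimately show ?thesis using n False by (simp add: schemmel_D_def)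
qed

section \<open>The case \<open>m = 2\<close>: prime factors modulo 3\<close>

text \<open>Primes that are 0 or 1 modulo 3 only multiply to 0 or 1; the induction strips off primes
  that are 1.\<close>

lemma prime_factor_2_mod_3:
  fixes x :: nat
  assumes "x mod 3 = 2"
  shows "\<exists>q. prime q \<and> q mod 3 = 2 \<and> q dvd x"
  using assms
proof (induction x rule: less_induct)
  case (less x)
  then have "x \<noteq> 1" by auto
  then obtain p where p: "prime p" "p dvd x" using prime_factor_nat by blast
  then obtain y where y: "x = p * y" by blast
  have "p mod 3 = 2 \<or> p mod 3 = 1 \<or> p mod 3 = 0" by linarith
  then show ?case
  proof (elim disjE)
    assume "p mod 3 = 1"
    then have "x mod 3 = y mod 3" unfolding y by (metis mod_mult_left_eq mult_1)
    moreover have "y < x"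
      using y p less.prems prime_gt_1_nat[of p] by (cases "y = 0") auto
    ultimately obtain q where "prime q" "q mod 3 = 2" "q dvd y" using less by auto
    then show ?thesis using y by auto
  next
    assume "p mod 3 = 0"
    then have "x mod 3 = 0" unfolding y by auto
    then show ?thesis using less.prems by simp
  qed (use p in blast)
qed

text \<open>A prime \<open>p\<close> that is 1 modulo 3 contributes the factor \<open>p - 2\<close>, which is 2 modulo 3;
  a prime that is 2 modulo 3 contributes a factor 3, and so does \<open>9\<close>.\<close>

lemma schemmel_2_dichotomy:
  assumes "x > 1" "x \<noteq> 3"
  shows "3 dvd schemmel 2 x \<or> (\<exists>q. prime q \<and> q mod 3 = 2 \<and> q dvd schemmel 2 x)"
proof (cases "\<exists>p. prime p \<and> p dvd x \<and> p \<noteq> 3")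
  case True
  then obtain p where p: "prime p" "p dvd x" "p \<noteq> 3" by blast
  have d: "(p - 2) dvd schemmel 2 x" using prime_minus_dvd_schemmel p by simp
  have "\<not> 3 dvd p" using p primes_dvd_imp_eq[of 3 p] by auto
  moreover obtain t where t: "p = t + 2"
    using p prime_ge_2_nat le_Suc_ex[of 2 p] by (metis add.commute)
  ultimately have "t mod 3 = 2 \<or> t mod 3 = 0" by presburger
  then have "(p - 2) mod 3 = 2 \<or> (p - 2) mod 3 = 0" using t by simp
  then show ?thesis
  proof
    assume "(p - 2) mod 3 = 2"
    then show ?thesis using d prime_factor_2_mod_3 dvd_trans by blast
  next
    assume "(p - 2) mod 3 = 0"
    then have "3 dvd p - 2" by (rule mod_0_imp_dvd)
    then show ?thesis using d dvd_trans by blast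
  qed
next
  case False
  \<comment> \<open>Now \<open>x\<close> is a power of 3, and at least 9.\<close>
  then have all: "p = 3" if "prime p" "p dvd x" for p using that by blast
  then have "3 dvd x" using assms prime_factor_nat[of x] by auto
  then obtain y where y: "x = 3 * y" by blast
  then have "y \<noteq> 1" using assms by auto
  then obtain p where p: "prime p" "p dvd y" using prime_factor_nat[of y] by auto
  then have "p = 3" using all y by simp
  then have "3 dvd y" using p by simp
  then have "3 * 3 dvd x" using y by auto
  then show ?thesis using prime_dvd_schemmel[of 3 2 x] by simp
qed

lemma three_dvd_schemmel_2:
  assumes "prime q" "q mod 3 = 2" "q dvd x"
  shows "3 dvd schemmel 2 x"
proof -
  \<comment> \<open>This includes \<open>q = 2\<close>, where \<open>q - 2 = 0\<close>.\<close>
  have "3 dvd q - 2" using assms(2) by presburger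
  moreover have "q - 2 dvd schemmel 2 x" using assms by (intro prime_minus_dvd_schemmel) simp_all
  ultimately show ?thesis by (rule dvd_trans)
qed

text \<open>The two bounds feed each other. If 3 divides \<open>n\<close>, the dichotomy gives
  \<open>schemmel_D 2 ?L < 2 * ?L\<close>, for a total below \<open>3 * ?L \<le> n\<close>. In the
  other case 3 divides \<open>?L\<close>, for a total below \<open>2 * ?L < 2 * n\<close>.\<close>

lemma schemmel_D_2_bounds:
  assumes "n > 0"
  shows "(3 dvd n \<longrightarrow> schemmel_D 2 n < n) \<and>
    ((\<exists>q. prime q \<and> q mod 3 = 2 \<and> q dvd n) \<longrightarrow> schemmel_D 2 n < 2 * n)"
  using assms
proof (induction n rule: less_induct)
  case (less n)
  let ?L = "schemmel 2 n"
  show ?case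
  proof (cases "n > 1")
    case False
    then show ?thesis using less.prems schemmel_D_le_1[of n 2] by (auto intro: Nat.gr0I)
  next
    case n: True
    have rec: "schemmel_D 2 n = ?L + schemmel_D 2 ?L" using schemmel_D_rec n by simp
    have lt: "?L < n" using schemmel_less n by simp
    show ?thesis
    proof (cases "?L \<le> 1")
      case True
      then show ?thesis using rec lt schemmel_D_le_1[OF True, of 2] by simp
    next
      case False
      have "schemmel_D 2 n < n" if "3 dvd n"
      proof -
        have "schemmel 2 3 = 1" using schemmel_prime_power[of 3 2 0] by simp
        then have "n \<noteq> 3" using False by auto
        then have "schemmel_D 2 ?L < 2 * ?L"
          using schemmel_2_dichotomy[OF n] less.IH[OF lt] False by fastforce
        moreover have "3 * ?L \<le> n" using schemmel_prime_bound[of 3 2 n] that by simp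
        ultimately show ?thesis using rec by simp
      qed
      moreover have "schemmel_D 2 n < 2 * n" if q: "prime q" "q mod 3 = 2" "q dvd n" for q
        using less.IH[OF lt] False three_dvd_schemmel_2[OF q] rec lt by simp
      ultimately show ?thesis by blast
    qed
  qed
qed

text \<open>The factor 5 contributes a factor 3 to the first iterate; since \<open>n \<noteq> 5\<close>, there is
  besides it another 3, a 5, or some prime factor that is 2 modulo 3.\<close>

lemma three_dvd_schemmel_2_twice:
  assumes n: "n > 0" "n \<noteq> 5" and 5: "5 dvd n" and 3: "\<not> 3 dvd n"
  shows "3 dvd schemmel 2 (schemmel 2 n)"
proof -
  obtain a k where ak: "n = 5 ^ Suc a * k" "\<not> 5 dvd k"
    using prime_power_split[of 5 n] n 5 by auto
  have L: "schemmel 2 n = 5 ^ a * 3 * schemmel 2 k"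
    using schemmel_split[of 5 2 k a] ak by simp
  show ?thesis
  proof (cases a)
    case (Suc b)
    then have "5 dvd schemmel 2 n" using L by simp
    then show ?thesis using three_dvd_schemmel_2[of 5] by simp
  next
    case 0
    \<comment> \<open>Here \<open>n = 5 * k\<close>: \<open>k = 1\<close> would give
      \<open>n = 5\<close>, and \<open>k = 3\<close> would make 3 divide \<open>n\<close>.\<close>
    then have "k > 1" "k \<noteq> 3" using ak n 3 by (cases k; auto)+
    from schemmel_2_dichotomy[OF this] show ?thesis
    proof (elim disjE exE conjE)
      assume "3 dvd schemmel 2 k"
      \<comment> \<open>One 3 is \<open>5 - 2\<close>, the other comes from \<open>k\<close>; one of
        them survives the next application.\<close>
      then have "3 * 3 dvd schemmel 2 n" unfolding L by (metis dvd_mult mult.assoc mult_dvd_mono dvd_refl)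
      then show ?thesis using prime_dvd_schemmel[of 3 2] by simp
    next
      fix q assume "prime q" "q mod 3 = 2" "q dvd schemmel 2 k"
      then show ?thesis using three_dvd_schemmel_2[of q] L by simp
    qed
  qed
qed

lemma schemmel_D_2_less:
  assumes n: "n > 0" and 5: "5 dvd n"
  shows "schemmel_D 2 n < n"
proof (cases "3 dvd n \<or> schemmel 2 n \<le> 1")
  case True
  have "n > 1" using assms by (auto dest: dvd_imp_le)
  then show ?thesis
    using True schemmel_D_2_bounds[OF n] schemmel_D_rec[of 2 n] schemmel_less[of 2 n]
      schemmel_D_le_1[of "schemmel 2 n" 2] by auto
next
  case False
  let ?L = "schemmel 2 n"
  let ?M = "schemmel 2 ?L"
  have "n > 1" using assms by (auto dest: dvd_imp_le)
  then have D: "schemmel_D 2 n = ?L + ?M + schemmel_D 2 ?M"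
    using False schemmel_D_rec[of 2 n] schemmel_D_rec[of 2 ?L] by simp
  have L: "5 * ?L \<le> 3 * n" using schemmel_prime_bound[of 5 2 n] 5 by simp
  have "3 dvd ?L" using three_dvd_schemmel_2[of 5 n] 5 by simp
  then have M: "3 * ?M \<le> ?L" using schemmel_prime_bound[of 3 2 ?L] by simp
  show ?thesis
  proof (cases "?M \<le> 1")
    case True
    \<comment> \<open>The last summand is 0, and \<open>?L + ?M\<close> is at most
      \<open>4 * n / 5\<close>.\<close>
    then show ?thesis using D L M False schemmel_D_le_1[OF True, of 2] by linarith
  next
    case M1: False
    have "n \<noteq> 5"
    proof
      assume "n = 5"
      then have "?L = 3" using schemmel_prime_power[of 5 2 0] by simp
      then show False using M M1 by simp
    qed
    then have "schemmel_D 2 ?M < ?M"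
      using three_dvd_schemmel_2_twice assms False M1 schemmel_D_2_bounds[of ?M] by simp
    then show ?thesis using D L M by linarith
  qed
qed

theorem theorem2p4:
  fixes m n :: nat
  assumes "m > 1" and "m \<noteq> 4" and "n > 0" and "5 dvd n"
  shows "schemmel_D m n < n"
proof -
  have n: "n > 1" using assms by (auto dest: dvd_imp_le)
  let ?L = "schemmel m n"
  have rec: "schemmel_D m n = ?L + schemmel_D m ?L" using schemmel_D_rec n assms by simp
  have lt: "?L < n" using schemmel_less n assms by simp
  \<comment> \<open>The divisor is 2 for \<open>m = 3\<close> and, by truncation, 0 for
    \<open>m \<ge> 5\<close>.\<close>
  have d: "(5 - m) dvd ?L" using prime_minus_dvd_schemmel[of 5 m n] assms by simp
  consider "m = 2" | "m = 3" | "m \<ge> 5" using assms by linarith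
  then show ?thesis
  proof cases
    case 1
    then show ?thesis using schemmel_D_2_less assms by simp
  next
    case 2
    \<comment> \<open>Since 2 divides \<open>?L\<close> and \<open>2 - m\<close> truncates to 0, the
      second iterate vanishes.\<close>
    then have "(2 - m) dvd schemmel m ?L"
      using prime_minus_dvd_schemmel[of 2 m ?L] d by simp
    then have "schemmel m ?L = 0" using 2 by simp
    then have "schemmel_D m ?L = 0"
      using schemmel_D_rec[of m ?L] schemmel_D_le_1[of ?L m] schemmel_D_le_1[of 0 m] 2
      by (cases "?L > 1") auto
    then show ?thesis using rec lt by simp
  next
    case 3
    then have "?L = 0" using d by simp
    then show ?thesis using rec lt schemmel_D_le_1[of 0 m] by simp
  qed
qed

end
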